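(* For every $r\ge2$, $$a_3(r)<a_5(r).$$ Furthermore, $a_5(2)=a_7(2)=2$, and $$a_5(r)<a_7(r)\qquad(r\ge3).$$
   Context: For an odd integer $q\ge3$, a $q$-admissible word of order $r\ge1$ is a finite word $w=(x_1,\dots,x_L)$ with each $x_j\in\{q/2,\,1/2\}$, containing exactly $r$ occurrences of $q/2$, such that $\prod_{j=1}^{\ell}x_j>1$ for all $1\le \ell<L$ and $\prod_{j=1}^{L}x_j<1$. Let $a_q(r)$ be the number of $q$-admissible words of order $r$. The sequences $a_3(r),a_5(r),a_7(r)$ are the OEIS sequences A100982$(r)$, A174795$(r)$, A174796$(r)$ respectively. *)

theory Defs
  imports Complex_Main
begin

definition admissible_word :: "nat \<Rightarrow> nat \<Rightarrow> rat list \<Rightarrow> bool" where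
  "admissible_word q r w \<longleftrightarrow>
     set w \<subseteq> {of_nat q / 2, 1 / 2} \<and>
     count_list w (of_nat q / 2) = r \<and>
     (\<forall>l. 1 \<le> l \<and> l < length w \<longrightarrow> prod_list (take l w) > 1) \<and>
     prod_list w < 1"

definition num_admissible :: "nat \<Rightarrow> nat \<Rightarrow> nat" where
  "num_admissible q r = card {w. admissible_word q r w}"

lemma prod_list_letters:
  fixes w :: "rat list"
  assumes "q \<noteq> 1" "set w \<subseteq> {of_nat q / 2, 1 / 2}"
  shows "prod_list w = of_nat q ^ count_list w (of_nat q / 2) / 2 ^ length w"
  using assms(2)
proof (induction w)
  case (Cons x w)
  have IH: "prod_list w = of_nat q ^ count_list w (of_nat q / 2) / 2 ^ length w"
    using Cons by simp
  have ne: "(1 / 2 :: rat) \<noteq> of_nat q / 2" using assms(1) by simp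
  from Cons.prems consider "x = of_nat q / 2" | "x = 1 / 2" by auto
  then show ?case
  proof cases
    case 1
    then show ?thesis unfolding 1 by (simp add: IH)
  next
    case 2
    show ?thesis unfolding 2 using ne by (simp add: IH)
  qed
qed simp

text \<open>The cardinality above is that of a finite set, so it is a genuine count.\<close>

lemma finite_admissible_words:
  assumes "q \<ge> 3"
  shows "finite {w. admissible_word q r w}"
proof (rule finite_subset)
  show "{w. admissible_word q r w} \<subseteq>
      {w. set w \<subseteq> {of_nat q / 2, 1 / 2} \<and> length w \<le> q ^ r + 1}"
  proof safe
    fix w assume w: "admissible_word q r w"
    then show "x = 1 / 2" if "x \<in> set w" "x \<noteq> of_nat q / 2" for x
      using that by (auto simp: admissible_word_def)
    show "length w \<le> q ^ r + 1"
    proof (cases "length w \<le> 1")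
      case False
      define l where "l = length w - 1"
      define u where "u = take l w"
      have "set u \<subseteq> {of_nat q / 2, 1 / 2}"
        using w set_take_subset[of l w] by (auto simp: u_def admissible_word_def)
      then have "prod_list u = of_nat q ^ count_list u (of_nat q / 2) / 2 ^ length u"
        using prod_list_letters assms by auto
      moreover have "1 \<le> l" "l < length w" using False by (auto simp: l_def)
      then have "prod_list u > 1" "length u = l"
        using w by (simp_all add: u_def admissible_word_def)
      ultimately have "(1 :: rat) < of_nat q ^ count_list u (of_nat q / 2) / 2 ^ l"
        by metis
      then have "(of_nat (2 ^ l) :: rat) < of_nat (q ^ count_list u (of_nat q / 2))"
        by (simp add: field_simps)
      then have "2 ^ l < q ^ count_list u (of_nat q / 2)"
        by (simp only: of_nat_less_iff)
      also have "count_list u (of_nat q / 2) \<le> count_list w (of_nat q / 2)"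
        by (metis append_take_drop_id count_list_append le_add1 u_def)
      then have "q ^ count_list u (of_nat q / 2) \<le> q ^ r"
        using w assms by (intro power_increasing) (auto simp: admissible_word_def)
      finally have "2 ^ l < q ^ r" .
      then have "l < q ^ r" using less_exp[of l] by linarith
      then show ?thesis by (simp add: l_def)
    qed simp
  qed
qed (rule finite_lists_length_le, simp)

end

theory Submission imports Defs begin

text \<open>
  An admissible word of order \<open>r \<ge> 1\<close> has length \<open>N\<close>, the least number with \<open>q ^ r < 2 ^ N\<close>. Recording
  only which letters equal \<open>q/2\<close>, it becomes a Boolean word of length \<open>N\<close> with \<open>r\<close> entries \<open>True\<close>, all
  of whose proper nonempty prefixes satisfy \<open>2 ^ l < q ^ k\<close>, where \<open>l\<close> is the length and \<open>k\<close> the number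
  of entries \<open>True\<close>. If \<open>p < q\<close>, padding with \<open>False\<close> embeds the words for \<open>p\<close> into those for \<open>q\<close>. If
  moreover \<open>p ^ k < 2 ^ (k + m) < q ^ k\<close> for some \<open>k < r\<close>, then the word
  \<open>True\<^sup>k False\<^sup>m True\<^sup>r\<^sup>-\<^sup>k False \<dots> False\<close> is not in the image. This applies to \<open>3 < 4 < 5\<close>, where \<open>k = m = 1\<close>,
  and to \<open>25 < 32 < 49\<close>, where \<open>k = 2\<close> and \<open>m = 3\<close>.
\<close>

section \<open>Boolean encoding of admissible words\<close>

definition word_length :: "nat \<Rightarrow> nat \<Rightarrow> nat" where
  "word_length q r = (LEAST n. q ^ r < 2 ^ n)"

definition bool_words :: "nat \<Rightarrow> nat \<Rightarrow> bool list set" where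
  "bool_words q r = {b. length b = word_length q r \<and> count_list b True = r \<and>
     (\<forall>l. 1 \<le> l \<and> l < word_length q r \<longrightarrow> 2 ^ l < q ^ count_list (take l b) True)}"

definition letter :: "nat \<Rightarrow> bool \<Rightarrow> rat" where
  "letter q x = (if x then of_nat q / 2 else 1 / 2)"

lemma power_less_word_length: "q ^ r < 2 ^ word_length q r"
  unfolding word_length_def by (rule LeastI[of _ "q ^ r"]) (rule less_exp)

lemma word_length_le: "q ^ r < 2 ^ n \<Longrightarrow> word_length q r \<le> n"
  unfolding word_length_def by (rule Least_le)

text \<open>Minimality of \<open>word_length q r\<close> gives only
  \<open>2 ^ l \<le> q ^ r\<close>. Equality is excluded by parity: for \<open>l \<ge> 1\<close> the
  left side is even, and the right side is odd.\<close>

lemma less_word_length_iff: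
  assumes "odd q" "l \<ge> 1"
  shows "l < word_length q r \<longleftrightarrow> 2 ^ l < q ^ r"
proof
  assume "l < word_length q r"
  then have "2 ^ l \<le> q ^ r"
    using word_length_le[of q r l] by (metis not_le)
  moreover have "2 ^ l \<noteq> q ^ r"
    using assms by (metis even_numeral even_power not_one_le_zero gr0I)
  ultimately show "2 ^ l < q ^ r" by simp
next
  assume "2 ^ l < q ^ r"
  then have "(2::nat) ^ l < 2 ^ word_length q r"
    using power_less_word_length[of q r] by linarith
  then show "l < word_length q r" by simp
qed

lemma word_length_mono:
  assumes "p \<le> q"
  shows "word_length p r \<le> word_length q r"
  by (rule word_length_le, rule le_less_trans[OF power_mono[OF assms] power_less_word_length]) simp

lemma count_list_replicate: "count_list (replicate n y) x = (if x = y then n else 0)"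
  by (induction n) auto

lemma count_list_take_mono: "i \<le> j \<Longrightarrow> count_list (take i xs) x \<le> count_list (take j xs) x"
  by (metis append_take_drop_id count_list_append le_add1 min.absorb1 take_take)

text \<open>Numerator and denominator are casts of whole naturals, so that comparing the product
  with 1 turns directly into an inequality between naturals.\<close>

lemma prod_list_map_letter:
  "prod_list (map (letter q) b) = of_nat (q ^ count_list b True) / of_nat (2 ^ length b)"
  by (induction b) (auto simp: letter_def)

lemma inj_letter: "q \<noteq> 1 \<Longrightarrow> inj (letter q)"
  by (auto simp: inj_def letter_def)

lemma count_list_map_letter:
  assumes "q \<noteq> 1"
  shows "count_list (map (letter q) b) (of_nat q / 2) = count_list b True"
  using assms by (induction b) (auto simp: letter_def)

lemma admissible_word_map_letter:
  assumes "q \<noteq> 1"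
  shows "admissible_word q r (map (letter q) b) \<longleftrightarrow>
    count_list b True = r \<and>
    (\<forall>l. 1 \<le> l \<and> l < length b \<longrightarrow> 2 ^ l < q ^ count_list (take l b) True) \<and>
    q ^ r < 2 ^ length b"
proof -
  have gt: "prod_list (map (letter q) c) > 1 \<longleftrightarrow> 2 ^ length c < q ^ count_list c True" for c
    unfolding prod_list_map_letter
    by (subst less_divide_eq_1_pos, simp, simp only: of_nat_less_iff)
  have lt: "prod_list (map (letter q) c) < 1 \<longleftrightarrow> q ^ count_list c True < 2 ^ length c" for c
    unfolding prod_list_map_letter
    by (subst divide_less_eq_1_pos, simp, simp only: of_nat_less_iff)
  have set: "set (map (letter q) b) \<subseteq> {of_nat q / 2, 1 / 2}"
    by (auto simp: letter_def)
  show ?thesis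
    unfolding admissible_word_def take_map gt lt count_list_map_letter[OF assms]
    using set by auto
qed

text \<open>The length is forced. A final product below 1 needs length at least
  \<open>word_length q r\<close>. A longer word would have a proper prefix of exactly that length;
  with at most \<open>r\<close> entries \<open>True\<close>, its product would already be below
  1.\<close>

lemma admissible_word_map_letter_iff:
  assumes "odd q" "q \<ge> 3" "r \<ge> 1"
  shows "admissible_word q r (map (letter q) b) \<longleftrightarrow> b \<in> bool_words q r"
proof
  assume b: "b \<in> bool_words q r"
  then show "admissible_word q r (map (letter q) b)"
    using assms power_less_word_length[of q r]
    by (auto simp: admissible_word_map_letter bool_words_def)
next
  assume adm: "admissible_word q r (map (letter q) b)"
  then have b: "count_list b True = r" "q ^ r < 2 ^ length b"
    and pre: "\<And>l. 1 \<le> l \<Longrightarrow> l < length b \<Longrightarrow> 2 ^ l < q ^ count_list (take l b) True"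
    using assms by (auto simp: admissible_word_map_letter)
  have "length b \<le> word_length q r"
  proof (rule ccontr)
    assume less: "\<not> ?thesis"
    define l where "l = word_length q r"
    \<comment> \<open>As \<open>q ^ r\<close> is at least \<open>2 ^ 0\<close>, the length
      \<open>l\<close> is positive, so the prefix condition applies to it.\<close>
    have "q ^ r > 0" using assms by simp
    then have "l \<ge> 1"
      using power_less_word_length[of q r]
      by (metis One_nat_def Suc_leI l_def less_one gr0I less_irrefl power_0)
    then have "2 ^ l < q ^ count_list (take l b) True"
      using less by (intro pre) (auto simp: l_def)
    also have "\<dots> \<le> q ^ r"
      using count_list_take_mono[of l "length b" b True] less assms b
      by (intro power_increasing) (auto simp: l_def)
    finally show False
      using power_less_word_length[of q r] by (simp add: l_def)
  qed
  with word_length_le[OF b(2)] have "length b = word_length q r" by simp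
  with b pre show "b \<in> bool_words q r" by (simp add: bool_words_def)
qed

lemma num_admissible_eq_card:
  assumes "odd q" "q \<ge> 3" "r \<ge> 1"
  shows "num_admissible q r = card (bool_words q r)"
proof -
  have "{w. admissible_word q r w} = map (letter q) ` bool_words q r"
  proof safe
    fix w assume w: "admissible_word q r w"
    have "set w \<subseteq> range (letter q)"
      using w unfolding admissible_word_def letter_def by (auto simp: image_iff)
    then obtain b where b: "w = map (letter q) b"
      by (metis ex_map_conv imageE subsetD)
    with w show "w \<in> map (letter q) ` bool_words q r"
      using admissible_word_map_letter_iff[OF assms] by blast
  qed (simp add: admissible_word_map_letter_iff[OF assms])
  moreover have "inj (map (letter q))"
    using assms by (intro inj_mapI inj_letter) auto
  ultimately show ?thesis
    unfolding num_admissible_def by (metis card_image inj_on_subset subset_UNIV)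
qed

section \<open>Strict comparison of two multipliers\<close>

lemma finite_bool_words: "finite (bool_words q r)"
  by (rule finite_subset[OF _ finite_lists_length_eq[of UNIV "word_length q r"]])
    (auto simp: bool_words_def)

text \<open>A prefix that ends before the end of \<open>b\<close> inherits its inequality from
  \<open>p \<le> q\<close>. Any longer prefix contains all \<open>r\<close> entries
  \<open>True\<close>, and then \<open>l < word_length q r\<close> suffices.\<close>

lemma bool_words_pad:
  assumes "odd q" "p \<le> q" "b \<in> bool_words p r"
  shows "b @ replicate (word_length q r - word_length p r) False \<in> bool_words q r"
    (is "?c \<in> _")
proof -
  have b: "length b = word_length p r" "count_list b True = r"
    and pre: "\<And>l. 1 \<le> l \<Longrightarrow> l < word_length p r \<Longrightarrow> 2 ^ l < p ^ count_list (take l b) True"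
    using assms(3) by (auto simp: bool_words_def)
  have "2 ^ l < q ^ count_list (take l ?c) True" if l: "1 \<le> l" "l < word_length q r" for l
  proof (cases "l < word_length p r")
    case True
    with l have "2 ^ l < p ^ count_list (take l b) True" by (intro pre)
    also have "\<dots> \<le> q ^ count_list (take l b) True"
      using assms by (intro power_mono) auto
    finally show ?thesis using True b by simp
  next
    case False
    with b have "count_list (take l ?c) True = r" by (simp add: count_list_replicate)
    with l assms show ?thesis by (simp add: less_word_length_iff)
  qed
  with b word_length_mono[OF assms(2), of r] show ?thesis
    by (auto simp: bool_words_def count_list_replicate)
qed

lemma num_admissible_less:
  assumes "odd p" "p \<ge> 3" "odd q" "p < q"
    and "k < r" "p ^ k < 2 ^ (k + m)" "2 ^ (k + m) < q ^ k"
  shows "num_admissible p r < num_admissible q r"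
proof -
  define N where "N = word_length q r"
  define pad where "pad b = b @ replicate (N - word_length p r) False" for b
  define c where "c = replicate k True @ replicate m False @ replicate (r - k) True @
    replicate (N - (m + r)) False"
  have r: "r \<ge> 1" and q: "q \<ge> 3" using assms by auto

  \<comment> \<open>The part of \<open>c\<close> before the final padding still has product above 1,
    so it is shorter than \<open>N\<close> and the padding is nonempty.\<close>
  have "(2::nat) ^ (m + r) = 2 ^ (k + m) * 2 ^ (r - k)"
    using assms by (simp flip: power_add)
  also have "\<dots> < q ^ k * q ^ (r - k)"
    using assms by (intro mult_less_le_imp_less power_mono) auto
  also have "\<dots> = q ^ r"
    using assms by (simp flip: power_add)
  finally have "m + r < N"
    using less_word_length_iff[OF assms(3), of "m + r" r] r by (simp add: N_def)
  then have len: "length c = N"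
    using assms by (simp add: c_def)

  \<comment> \<open>Within the run of \<open>False\<close> the product is smallest at its end
    \<open>k + m\<close>, where the hypothesis bounds it. Each run of \<open>True\<close> only
    increases the product, as \<open>q > 2\<close>.\<close>
  have "2 ^ l < q ^ count_list (take l c) True" if l: "1 \<le> l" "l < N" for l
  proof -
    consider "l \<le> k" | "k < l" "l \<le> k + m" | "k + m < l" "l \<le> m + r" | "m + r < l"
      by linarith
    then show ?thesis
    proof cases
      case 1
      then have "count_list (take l c) True = l"
        by (simp add: c_def count_list_replicate)
      with l q show ?thesis by (simp add: power_strict_mono)
    next
      case 2
      then have "count_list (take l c) True = k"
        by (simp add: c_def count_list_replicate)
      moreover have "(2::nat) ^ l \<le> 2 ^ (k + m)" using 2 by (intro power_increasing) auto
      ultimately show ?thesis using assms(7) by (metis le_less_trans)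
    next
      case 3
      define j where "j = l - (k + m)"
      have j: "l = (k + m) + j" "j \<le> r - k" using 3 by (auto simp: j_def)
      then have "count_list (take l c) True = k + j"
        by (simp add: c_def count_list_replicate)
      moreover have "2 ^ (k + m) * 2 ^ j < q ^ k * q ^ j"
        using assms by (intro mult_less_le_imp_less power_mono) auto
      ultimately show ?thesis by (simp add: j(1) power_add)
    next
      case 4
      then have "count_list (take l c) True = r"
        using assms by (simp add: c_def count_list_replicate)
      with l assms show ?thesis by (simp add: less_word_length_iff N_def)
    qed
  qed
  with len have c_in: "c \<in> bool_words q r"
    using assms by (simp add: bool_words_def N_def) (simp add: c_def count_list_replicate)

  \<comment> \<open>Look at the prefix of length \<open>k + m\<close>, which has \<open>k\<close>
    entries \<open>True\<close>. If it is a proper prefix of \<open>b\<close>, its product for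
    \<open>p\<close> is below 1; otherwise it contains all of \<open>b\<close>, hence
    \<open>r > k\<close> entries \<open>True\<close>.\<close>
  have c_notin: "c \<notin> pad ` bool_words p r"
  proof
    assume "c \<in> pad ` bool_words p r"
    then obtain b where b: "b \<in> bool_words p r" and c: "c = pad b" by blast
    have take_c: "count_list (take (k + m) c) True = k"
      by (simp add: c_def count_list_replicate)
    show False
    proof (cases "k + m < length b")
      case True
      then have "count_list (take (k + m) b) True = k"
        using take_c by (simp add: c pad_def)
      moreover have "k + m \<ge> 1" using assms(6) by (cases "k + m") auto
      ultimately have "2 ^ (k + m) < p ^ k"
        using True b unfolding bool_words_def by force
      with assms show False by simp
    next
      case False
      then have "count_list (take (k + m) c) True = count_list b True"
        by (simp add: c pad_def count_list_replicate)
      with take_c b assms show False by (simp add: bool_words_def)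
    qed
  qed

  have "pad ` bool_words p r \<subset> bool_words q r"
    using bool_words_pad[of q p _ r] c_in c_notin assms by (auto simp: pad_def N_def)
  then have "card (pad ` bool_words p r) < card (bool_words q r)"
    by (intro psubset_card_mono finite_bool_words)
  moreover have "inj pad" by (auto simp: inj_def pad_def)
  ultimately have "card (bool_words p r) < card (bool_words q r)"
    by (metis card_image inj_on_subset subset_UNIV)
  then show ?thesis
    using assms q r by (simp add: num_admissible_eq_card)
qed

section \<open>Words of order two for the multipliers 5 and 7\<close>

lemma word_length_5_2: "word_length 5 2 = 5"
  unfolding word_length_def
proof (rule Least_equality)
  show "5 \<le> n" if "5 ^ 2 < (2::nat) ^ n" for n
  proof (rule ccontr)
    assume "\<not> 5 \<le> n"
    then have "(2::nat) ^ n \<le> 2 ^ 4" by (intro power_increasing) auto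
    with that show False by simp
  qed
qed simp

lemma word_length_7_2: "word_length 7 2 = 6"
  unfolding word_length_def
proof (rule Least_equality)
  show "6 \<le> n" if "7 ^ 2 < (2::nat) ^ n" for n
  proof (rule ccontr)
    assume "\<not> 6 \<le> n"
    then have "(2::nat) ^ n \<le> 2 ^ 5" by (intro power_increasing) auto
    with that show False by simp
  qed
qed simp

text \<open>For order 2, only the prefix conditions at lengths 1 and 3 matter: the first letter is
  \<open>True\<close>, and both occurrences of \<open>True\<close> are among the first three letters.\<close>

lemma bool_words_2:
  assumes "q \<in> {5, 7}"
  shows "bool_words q 2 = {[True, True, False] @ replicate (word_length q 2 - 3) False,
    [True, False, True] @ replicate (word_length q 2 - 3) False}" (is "_ = ?R")
proof
  have len: "word_length q 2 \<ge> 5" "word_length q 2 \<le> 6"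
    using assms by (auto simp: word_length_5_2 word_length_7_2)
  have odd: "odd q" "q \<ge> 3" using assms by auto
  show "bool_words q 2 \<subseteq> ?R"
  proof
    fix b assume "b \<in> bool_words q 2"
    then have b: "length b = word_length q 2" "count_list b True = 2"
      and pre: "\<And>l. 1 \<le> l \<Longrightarrow> l < word_length q 2 \<Longrightarrow> 2 ^ l < q ^ count_list (take l b) True"
      by (auto simp: bool_words_def)
    have split: "count_list (take 3 b) True + count_list (drop 3 b) True = 2"
      by (metis append_take_drop_id b(2) count_list_append)
    \<comment> \<open>Since \<open>2 ^ 3\<close> exceeds both 5 and 7, fewer than two entries
      \<open>True\<close> are too few at length 3.\<close>
    have "count_list (take 3 b) True \<noteq> 0" "count_list (take 3 b) True \<noteq> 1"
      using pre[of 3] len assms by (auto intro!: gr0I)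
    with split have t: "count_list (take 3 b) True = 2" and d: "count_list (drop 3 b) True = 0"
      by linarith+
    have "drop 3 b = replicate (word_length q 2 - 3) False"
      using d b(1) by (intro replicate_eqI) (auto simp: count_list_0_iff)
    moreover obtain x y z where xyz: "take 3 b = [x, y, z]"
      using len b(1) by (cases b; cases "tl b"; cases "tl (tl b)") (auto simp: numeral_3_eq_3)
    moreover have "count_list (take 1 b) True \<noteq> 0"
      using pre[of 1] len by (auto intro!: gr0I)
    then have x
      using xyz by (cases b) (auto simp: numeral_3_eq_3 split: if_splits)
    then have "[x, y, z] \<in> {[True, True, False], [True, False, True]}"
      using t xyz by (auto split: if_splits)
    ultimately show "b \<in> ?R"
      by (metis append_take_drop_id insert_iff singletonD)
  qed
  have "b @ replicate (word_length q 2 - 3) False \<in> bool_words q 2"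
    if "b \<in> {[True, True, False], [True, False, True]}" for b
  proof -
    have "2 ^ l < q ^ count_list (take l (b @ replicate (word_length q 2 - 3) False)) True"
      if l: "1 \<le> l" "l < word_length q 2" for l
    proof (cases "l < 3")
      case True
      \<comment> \<open>A single \<open>True\<close> is enough at these lengths, because
        \<open>2 ^ 2 < 5\<close>.\<close>
      then have "l = 1 \<or> l = 2" using l by auto
      with \<open>b \<in> _\<close> show ?thesis using assms by auto
    next
      case False
      then have "count_list (take l (b @ replicate (word_length q 2 - 3) False)) True = 2"
        using \<open>b \<in> _\<close> by (auto simp: count_list_replicate)
      with l odd show ?thesis by (simp add: less_word_length_iff)
    qed
    with that len show ?thesis by (auto simp: bool_words_def count_list_replicate)
  qed
  then show "?R \<subseteq> bool_words q 2" by blast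
qed

lemma num_admissible_2:
  assumes "q \<in> {5, 7}"
  shows "num_admissible q 2 = 2"
proof -
  have "num_admissible q 2 = card (bool_words q 2)"
    using assms by (intro num_admissible_eq_card) auto
  then show ?thesis unfolding bool_words_2[OF assms] by simp
qed

theorem corollary10:
  "(\<forall>r\<ge>2. num_admissible 3 r < num_admissible 5 r) \<and>
   num_admissible 5 2 = 2 \<and> num_admissible 7 2 = 2 \<and>
   (\<forall>r\<ge>3. num_admissible 5 r < num_admissible 7 r)"
proof (intro conjI allI impI)
  fix r :: nat assume "r \<ge> 2"
  then show "num_admissible 3 r < num_admissible 5 r"
    by (intro num_admissible_less[where k = 1 and m = 1]) auto
next
  fix r :: nat assume "r \<ge> 3"
  then show "num_admissible 5 r < num_admissible 7 r"
    \<comment> \<open>No power of two lies between 5 and 7, so \<open>k = 1\<close> is impossible;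
      \<open>k = 2\<close> requires \<open>r \<ge> 3\<close>.\<close>
    by (intro num_admissible_less[where k = 2 and m = 3]) auto
qed (simp_all add: num_admissible_2)

end
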